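(* Let $0<2k\le n\le N$, let $A\in\mathbb{R}^{n\times N}$ be such that any $2k$ of its columns are linearly independent, let $x^*\in\mathbb{R}^N$ have support $\Lambda=\mathrm{supp}(x^* )$ with $|\Lambda|=k$, let $e\in\mathbb{R}^n$ and $b=Ax^*+e$. Let $\underline{\alpha}>0$ and suppose there exists an $\underline{\alpha}$-stable point on some index set $\Gamma\subseteq\{1,\dots,N\}$ with $|\Gamma|=k$ and $\Gamma\neq\Lambda$. Then $$\left\|A_{\Gamma}^{\dagger}A_{\Lambda\setminus\Gamma}x^*_{\Lambda\setminus\Gamma}\right\|+\left\|A_{\Gamma}^{\dagger}e\right\|\;\geq\;\underline{\alpha}\left\{\left\|A_{\Lambda\setminus\Gamma}^T(I-A_{\Gamma}A^{\dagger}_{\Gamma})A_{\Lambda\setminus\Gamma}x^*_{\Lambda\setminus\Gamma}\right\|-\left\|A_{\Lambda\setminus\Gamma}^T(I-A_{\Gamma}A^{\dagger}_{\Gamma})e\right\|\right\}.$$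
   Context: $\|\cdot\|$ is the Euclidean norm. For an index set $\Gamma$, $x_\Gamma$ is the restriction of the vector $x$ to the entries indexed by $\Gamma$, $A_\Gamma$ the restriction of $A$ to the columns indexed by $\Gamma$, $\Gamma^C=\{1,\dots,N\}\setminus\Gamma$, and $A_\Gamma^\dagger=(A_\Gamma^TA_\Gamma)^{-1}A_\Gamma^T$. Stable points: given $\underline{\alpha}>0$ and an index set $\Gamma$ with $|\Gamma|=k$, a vector $\bar x\in\mathbb{R}^N$ is an $\underline{\alpha}$-stable point on $\Gamma$ (of the generic iterative hard thresholding algorithm for data $A,b,k$) if $\mathrm{supp}(\bar x)\subseteq\Gamma$, $\{A^T(b-A\bar x)\}_\Gamma=0$, and $\min_{i\in\Gamma}|\bar x_i|\ge\underline{\alpha}\max_{j\in\Gamma^C}|\{A^T(b-A\bar x)\}_j|$. *)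

theory Defs
  imports
    "HOL-Analysis.L2_Norm"
    "Jordan_Normal_Form.DL_Submatrix"
    "Jordan_Normal_Form.VS_Connect"
    "Jordan_Normal_Form.Gauss_Jordan_Elimination"
begin

text \<open>
  Dimensions are carried by the carriers \<open>carrier_vec\<close> and \<open>carrier_mat\<close>; the index set
  \<open>{1,\<dots>,N}\<close> is rendered zero-based as \<open>{..<N}\<close>.
\<close>

definition euclidean_norm :: "real vec \<Rightarrow> real" where
  "euclidean_norm v = L2_set (\<lambda>i. v $ i) {..<dim_vec v}"

definition supp :: "real vec \<Rightarrow> nat set" where
  "supp v = {i. i < dim_vec v \<and> v $ i \<noteq> 0}"

text \<open>
  The restrictions keep only the selected entries (columns), renumbered in increasing order of
  their index by \<open>pick\<close>, as in \<open>submatrix\<close>; nothing is padded by zeros.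
\<close>

definition restrict_vec :: "real vec \<Rightarrow> nat set \<Rightarrow> real vec" where
  "restrict_vec v \<Gamma> = vec (card {i. i < dim_vec v \<and> i \<in> \<Gamma>}) (\<lambda>i. v $ pick \<Gamma> i)"

definition restrict_cols :: "real mat \<Rightarrow> nat set \<Rightarrow> real mat" where
  "restrict_cols A \<Gamma> = submatrix A UNIV \<Gamma>"

text \<open>
  Independence of the columns as a family: \<open>lin_dep\<close> is a property of the \<^emph>\<open>set\<close> of columns,
  so repeated columns have to be excluded separately.
\<close>

definition lin_indpt_cols :: "real mat \<Rightarrow> bool" where
  "lin_indpt_cols B \<longleftrightarrow> distinct (cols B) \<and>
     \<not> LinearCombinations.module.lin_dep class_ring (module_vec TYPE(real) (dim_row B)) (set (cols B))"

text \<open>Only meaningful if the Gram matrix is invertible, that is, \<open>B\<close> has full column rank.\<close>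

definition pinv :: "real mat \<Rightarrow> real mat" where
  "pinv B = the (mat_inverse (B\<^sup>T * B)) * B\<^sup>T"

text \<open>
  For the extrema to be over nonempty sets one needs \<open>0 < k < dim_col A\<close>.
\<close>

definition stable_point ::
    "real mat \<Rightarrow> real vec \<Rightarrow> nat \<Rightarrow> real \<Rightarrow> nat set \<Rightarrow> real vec \<Rightarrow> bool" where
  "stable_point A b k \<alpha> \<Gamma> x \<longleftrightarrow>
     \<Gamma> \<subseteq> {..<dim_col A} \<and> card \<Gamma> = k \<and>
     x \<in> carrier_vec (dim_col A) \<and> supp x \<subseteq> \<Gamma> \<and>
     restrict_vec (A\<^sup>T *\<^sub>v (b - A *\<^sub>v x)) \<Gamma> = 0\<^sub>v k \<and>
     Min ((\<lambda>i. \<bar>x $ i\<bar>) ` \<Gamma>)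
       \<ge> \<alpha> * Max ((\<lambda>j. \<bar>(A\<^sup>T *\<^sub>v (b - A *\<^sub>v x)) $ j\<bar>) ` ({..<dim_col A} - \<Gamma>))"

end

theory Submission
  imports Defs "Jordan_Normal_Form.DL_Rank"
begin

text \<open>
  Write \<open>B = A\<^sub>\<Gamma>\<close>, \<open>w = A\<^sub>\<Lambda>\<^sub>-\<^sub>\<Gamma> x*\<^sub>\<Lambda>\<^sub>-\<^sub>\<Gamma>\<close>. Stationarity on \<open>\<Gamma>\<close> means that the
  stable point \<open>x\<close> solves the normal equations there, so \<open>B\<^sup>\<dagger>(w + e)\<close> is \<open>x - x*\<close> on \<open>\<Gamma>\<close>, and
  the residual is \<open>(I - B B\<^sup>\<dagger>)(w + e)\<close>. On \<open>\<Gamma> - \<Lambda>\<close> the vector \<open>x*\<close> vanishes, so each of these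
  entries of \<open>B\<^sup>\<dagger>(w + e)\<close> is at least the minimum in the stability condition; each gradient entry
  on \<open>\<Lambda> - \<Gamma>\<close> is at most the maximum, in absolute value. As \<open>\<Gamma> - \<Lambda>\<close> and \<open>\<Lambda> - \<Gamma>\<close> are equinumerous, the Euclidean
  norms compare in the same way, and the triangle inequality separates \<open>w\<close> from \<open>e\<close>.
\<close>

section \<open>Enumeration of an index set and the restrictions built on it\<close>

lemma bij_betw_pick:
  assumes "finite S"
  shows "bij_betw (pick S) {..<card S} S"
proof (rule bij_betw_imageI)
  show "inj_on (pick S) {..<card S}"
    by (rule inj_onI) (metis card_pick_le lessThan_iff)
  show "pick S ` {..<card S} = S"
  proof
    show "pick S ` {..<card S} \<subseteq> S" using pick_in_set_le by blast
    show "S \<subseteq> pick S ` {..<card S}"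
    proof
      fix j assume j: "j \<in> S"
      \<comment> \<open>The position of \<open>j\<close> in the enumeration is its rank, the number
        of smaller elements of \<open>S\<close>; it stays below \<open>card S\<close> because
        \<open>j\<close> itself is not counted.\<close>
      then have "{a \<in> S. a < j} \<subset> S" by auto
      then have "card {a \<in> S. a < j} < card S" using assms by (simp add: psubset_card_mono)
      then show "j \<in> pick S ` {..<card S}" using pick_card_in_set[OF j] by force
    qed
  qed
qed

lemma card_restrict:
  assumes "S \<subseteq> {..<N}"
  shows "card {i. i < N \<and> i \<in> S} = card S"
  by (rule arg_cong[of _ _ card]) (use assms in auto)

lemma restrict_vec_carrier:
  assumes "v \<in> carrier_vec N" "S \<subseteq> {..<N}"
  shows "restrict_vec v S \<in> carrier_vec (card S)"
  using assms card_restrict[OF assms(2)] by (auto simp: restrict_vec_def)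

lemma restrict_vec_index:
  assumes "v \<in> carrier_vec N" "S \<subseteq> {..<N}" "i < card S"
  shows "restrict_vec v S $ i = v $ pick S i"
  using assms card_restrict[OF assms(2)] by (auto simp: restrict_vec_def)

lemma restrict_vec_diff:
  assumes u: "u \<in> carrier_vec N" and v: "v \<in> carrier_vec N" and S: "S \<subseteq> {..<N}"
  shows "restrict_vec (u - v) S = restrict_vec u S - restrict_vec v S"
proof (rule eq_vecI)
  have uv: "u - v \<in> carrier_vec N" using u v by simp
  note c = restrict_vec_carrier[OF _ S]
  show "dim_vec (restrict_vec (u - v) S) = dim_vec (restrict_vec u S - restrict_vec v S)"
    using c[OF uv] c[OF v] by simp
  fix i assume "i < dim_vec (restrict_vec u S - restrict_vec v S)"
  then have i: "i < card S" using c[OF v] by simp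
  then have "pick S i < N" using S pick_in_set_le by blast
  then show "restrict_vec (u - v) S $ i = (restrict_vec u S - restrict_vec v S) $ i"
    using i c[OF v] v restrict_vec_index[OF _ S i] u uv by simp
qed

lemma restrict_cols_carrier:
  assumes "A \<in> carrier_mat n N" "S \<subseteq> {..<N}"
  shows "restrict_cols A S \<in> carrier_mat n (card S)"
  using assms card_restrict[OF assms(2)] by (auto simp: restrict_cols_def submatrix_def)

lemma restrict_cols_index:
  assumes "A \<in> carrier_mat n N" "S \<subseteq> {..<N}" "i < n" "j < card S"
  shows "restrict_cols A S $$ (i, j) = A $$ (i, pick S j)"
  using assms card_restrict[OF assms(2)]
  by (auto simp: restrict_cols_def submatrix_def pick_UNIV)

lemma restrict_cols_col:
  assumes "A \<in> carrier_mat n N" "S \<subseteq> {..<N}" "j < card S"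
  shows "col (restrict_cols A S) j = col A (pick S j)"
proof -
  have "finite S" using assms(2) finite_subset by blast
  then have "pick S j < N" using assms(2,3) pick_in_set_le by blast
  then show ?thesis
    using assms restrict_cols_carrier[OF assms(1,2)]
    by (intro eq_vecI) (auto simp: restrict_cols_index[OF assms(1,2)])
qed

lemma sum_pick:
  assumes "finite S"
  shows "(\<Sum>i<card S. f (pick S i)) = sum f S"
  using sum.reindex_bij_betw[OF bij_betw_pick[OF assms]] .

lemma euclidean_norm_restrict_vec:
  assumes "v \<in> carrier_vec N" "S \<subseteq> {..<N}"
  shows "euclidean_norm (restrict_vec v S) = L2_set (\<lambda>i. v $ i) S"
proof -
  have "finite S" using assms(2) finite_subset by blast
  then have "(\<Sum>i<card S. (v $ pick S i)\<^sup>2) = (\<Sum>i\<in>S. (v $ i)\<^sup>2)"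
    by (rule sum_pick)
  then show ?thesis
    using restrict_vec_carrier[OF assms] restrict_vec_index[OF assms]
    by (simp add: euclidean_norm_def L2_set_def)
qed

section \<open>Products with restricted matrices\<close>

lemma mult_mat_vec_sum:
  assumes "A \<in> carrier_mat n N" "v \<in> carrier_vec N" "i < n"
  shows "(A *\<^sub>v v) $ i = (\<Sum>j<N. A $$ (i, j) * v $ j)"
  using assms by (auto simp: scalar_prod_def atLeast0LessThan)

lemma restrict_mult_sum:
  assumes A: "A \<in> carrier_mat n N" and v: "v \<in> carrier_vec N" and S: "S \<subseteq> {..<N}"
    and i: "i < n"
  shows "(restrict_cols A S *\<^sub>v restrict_vec v S) $ i = (\<Sum>j\<in>S. A $$ (i, j) * v $ j)"
proof -
  have "finite S" using S finite_subset by blast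
  have "(restrict_cols A S *\<^sub>v restrict_vec v S) $ i
      = (\<Sum>j<card S. A $$ (i, pick S j) * v $ pick S j)"
    using mult_mat_vec_sum[OF restrict_cols_carrier[OF A S] restrict_vec_carrier[OF v S] i]
      restrict_cols_index[OF A S i] restrict_vec_index[OF v S] by simp
  also have "\<dots> = (\<Sum>j\<in>S. A $$ (i, j) * v $ j)"
    using \<open>finite S\<close> by (rule sum_pick)
  finally show ?thesis .
qed

text \<open>Columns outside \<open>S\<close> meet only zero entries of \<open>v\<close>. This allows
  a product to be read over any index set that contains the support.\<close>

lemma restrict_mult_of_supp_subset:
  assumes A: "A \<in> carrier_mat n N" and v: "v \<in> carrier_vec N" and S: "S \<subseteq> {..<N}"
    and "supp v \<subseteq> S"
  shows "restrict_cols A S *\<^sub>v restrict_vec v S = A *\<^sub>v v"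
proof (rule eq_vecI)
  fix i assume "i < dim_vec (A *\<^sub>v v)"
  with A have i: "i < n" by simp
  have "(\<Sum>j\<in>S. A $$ (i, j) * v $ j) = (\<Sum>j<N. A $$ (i, j) * v $ j)"
    by (rule sum.mono_neutral_left) (use S v assms(4) in \<open>auto simp: supp_def\<close>)
  then show "(restrict_cols A S *\<^sub>v restrict_vec v S) $ i = (A *\<^sub>v v) $ i"
    using restrict_mult_sum[OF A v S i] mult_mat_vec_sum[OF A v i] by simp
qed (use A restrict_cols_carrier[OF A S] in auto)

lemma mult_restrict_split:
  assumes A: "A \<in> carrier_mat n N" and v: "v \<in> carrier_vec N" and S: "S \<subseteq> {..<N}"
  shows "A *\<^sub>v v = restrict_cols A S *\<^sub>v restrict_vec v S
    + restrict_cols A (supp v - S) *\<^sub>v restrict_vec v (supp v - S)"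
proof (rule eq_vecI)
  have T: "supp v - S \<subseteq> {..<N}" using v by (auto simp: supp_def)
  let ?l = "restrict_cols A S *\<^sub>v restrict_vec v S"
  let ?r = "restrict_cols A (supp v - S) *\<^sub>v restrict_vec v (supp v - S)"
  note r = carrier_matD(1)[OF restrict_cols_carrier[OF A T]]
  then show "dim_vec (A *\<^sub>v v) = dim_vec (?l + ?r)" using A by simp
  fix i assume "i < dim_vec (?l + ?r)"
  with r have i: "i < n" by simp
  have fin: "finite S" "finite (supp v - S)" using S T finite_subset by blast+
  have "(\<Sum>j<N. A $$ (i, j) * v $ j) = (\<Sum>j\<in>S \<union> (supp v - S). A $$ (i, j) * v $ j)"
    by (rule sum.mono_neutral_right) (use S T v in \<open>auto simp: supp_def\<close>)
  also have "\<dots> = (\<Sum>j\<in>S. A $$ (i, j) * v $ j) + (\<Sum>j\<in>supp v - S. A $$ (i, j) * v $ j)"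
    using fin by (intro sum.union_disjoint) auto
  finally show "(A *\<^sub>v v) $ i = (?l + ?r) $ i"
    using restrict_mult_sum[OF A v S i] restrict_mult_sum[OF A v T i] mult_mat_vec_sum[OF A v i]
      r i by simp
qed

text \<open>Serves twice: stationarity becomes orthogonality of the residual to the columns in
  \<Gamma>, and the gradient on \<Lambda> - \<Gamma> becomes a product with the transposed
  submatrix.\<close>

lemma restrict_transpose_mult:
  assumes A: "A \<in> carrier_mat n N" and S: "S \<subseteq> {..<N}"
  shows "(restrict_cols A S)\<^sup>T *\<^sub>v r = restrict_vec (A\<^sup>T *\<^sub>v r) S"
proof (rule eq_vecI)
  have c: "A\<^sup>T *\<^sub>v r \<in> carrier_vec N" using A by (intro carrier_vecI) simp
  note B = restrict_cols_carrier[OF A S]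
  show "dim_vec ((restrict_cols A S)\<^sup>T *\<^sub>v r) = dim_vec (restrict_vec (A\<^sup>T *\<^sub>v r) S)"
    using B restrict_vec_carrier[OF c S] by simp
  fix i assume "i < dim_vec (restrict_vec (A\<^sup>T *\<^sub>v r) S)"
  then have i: "i < card S" using restrict_vec_carrier[OF c S] by simp
  moreover have "pick S i < N" using S i pick_in_set_le by blast
  ultimately show "((restrict_cols A S)\<^sup>T *\<^sub>v r) $ i = restrict_vec (A\<^sup>T *\<^sub>v r) S $ i"
    using A B restrict_vec_index[OF c S i] restrict_cols_col[OF A S i] by simp
qed

section \<open>Zero padding, full column rank and the pseudoinverse\<close>

lemma restrict_vec_surj:
  assumes S: "S \<subseteq> {..<N}" and v: "v \<in> carrier_vec (card S)"
  obtains u where "u \<in> carrier_vec N" "supp u \<subseteq> S" "restrict_vec u S = v"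
proof -
  \<comment> \<open>The rank of \<open>j\<close> in \<open>S\<close> inverts \<open>pick S\<close>,
    so \<open>u\<close> is \<open>v\<close> spread over \<open>S\<close> and padded by
    zeros.\<close>
  define u where "u = vec N (\<lambda>j. if j \<in> S then v $ card {a \<in> S. a < j} else 0)"
  have u: "u \<in> carrier_vec N" by (simp add: u_def)
  have "u $ pick S i = v $ i" if "i < card S" for i
    using that S pick_in_set_le[OF that] card_pick_le[OF that] by (auto simp: u_def)
  then have "restrict_vec u S = v"
    using restrict_vec_carrier[OF u S] restrict_vec_index[OF u S] v
    by (intro eq_vecI) auto
  moreover have "supp u \<subseteq> S" by (auto simp: supp_def u_def split: if_splits)
  ultimately show ?thesis using u that by blast
qed

lemma restrict_vec_eq_0:
  assumes v: "v \<in> carrier_vec N" and S: "S \<subseteq> {..<N}" and "supp v \<subseteq> S"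
    and z: "restrict_vec v S = 0\<^sub>v (card S)"
  shows "v = 0\<^sub>v N"
proof (rule eq_vecI)
  fix j assume "j < dim_vec (0\<^sub>v N :: real vec)"
  then have j: "j < N" by simp
  have "finite S" using S finite_subset by blast
  have "v $ j = 0" if "j \<in> S"
  proof -
    from that obtain i where "i < card S" "j = pick S i"
      using bij_betw_pick[OF \<open>finite S\<close>] unfolding bij_betw_def by auto
    then show ?thesis using restrict_vec_index[OF v S] z by (metis index_zero_vec(1))
  qed
  then show "v $ j = 0\<^sub>v N $ j" using assms j by (auto simp: supp_def)
qed (use v in simp)

text \<open>As the columns are distinct, a nonzero kernel vector would be a dependence within the
  set of columns.\<close>

lemma lin_indpt_cols_inj:
  assumes B: "B \<in> carrier_mat n m" and "lin_indpt_cols B"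
    and "v \<in> carrier_vec m" "B *\<^sub>v v = 0\<^sub>v n"
  shows "v = 0\<^sub>v m"
proof -
  interpret vec_space "TYPE(real)" n .
  show ?thesis using assms lin_depI[OF B] by (auto simp: lin_indpt_cols_def)
qed

text \<open>Independence is assumed for sets of \<open>2 * k\<close> columns, while the
  pseudoinverse concerns only \<open>k\<close> of them. A kernel vector over \<open>S\<close>,
  padded by zeros, is a kernel vector over \<open>J\<close>.\<close>

lemma restrict_cols_inj_subset:
  assumes A: "A \<in> carrier_mat n N" and J: "J \<subseteq> {..<N}" and "S \<subseteq> J"
    and li: "lin_indpt_cols (restrict_cols A J)"
    and v: "v \<in> carrier_vec (card S)" and z: "restrict_cols A S *\<^sub>v v = 0\<^sub>v n"
  shows "v = 0\<^sub>v (card S)"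
proof -
  have S: "S \<subseteq> {..<N}" using assms by blast
  obtain u where u: "u \<in> carrier_vec N" "supp u \<subseteq> S" "restrict_vec u S = v"
    using restrict_vec_surj[OF S v] .
  then have uJ: "supp u \<subseteq> J" using \<open>S \<subseteq> J\<close> by blast
  have "restrict_cols A J *\<^sub>v restrict_vec u J = 0\<^sub>v n"
    using restrict_mult_of_supp_subset[OF A u(1) S u(2)]
      restrict_mult_of_supp_subset[OF A u(1) J uJ] u z by simp
  then have "restrict_vec u J = 0\<^sub>v (card J)"
    using lin_indpt_cols_inj[OF restrict_cols_carrier[OF A J] li restrict_vec_carrier[OF u(1) J]]
    by simp
  then have "u = 0\<^sub>v N" by (rule restrict_vec_eq_0[OF u(1) J uJ])
  then show ?thesis
    using u(3) restrict_vec_index[OF u(1) S] v S pick_in_set_le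
    by (intro eq_vecI) (auto, metis index_zero_vec(1) lessThan_iff subset_iff)
qed

text \<open>Pairing the Gram equation with \<open>v\<close> gives the squared norm of
  \<open>B *\<^sub>v v\<close>, which therefore vanishes.\<close>

lemma gram_inj:
  fixes B :: "real mat"
  assumes B: "B \<in> carrier_mat n m" and v: "v \<in> carrier_vec m"
    and z: "(B\<^sup>T * B) *\<^sub>v v = 0\<^sub>v m"
  shows "B *\<^sub>v v = 0\<^sub>v n"
proof -
  have Bv: "B *\<^sub>v v \<in> carrier_vec n" using B v by simp
  have "B\<^sup>T *\<^sub>v (B *\<^sub>v v) = 0\<^sub>v m" using assms by simp
  then have "(B *\<^sub>v v) \<bullet> (B *\<^sub>v v) = 0"
    using transpose_vec_mult_scalar[OF B v Bv] v by simp
  then show ?thesis using conjugate_square_eq_0_vec[OF Bv] by simp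
qed

text \<open>Injectivity makes the Gram matrix nonsingular, so \<open>the\<close> in
  \<open>pinv\<close> is applied to an actual inverse. The last claim holds because
  \<open>pinv B\<close> has \<open>B\<^sup>T\<close> as its right factor.\<close>

lemma
  assumes B: "B \<in> carrier_mat n m"
    and inj: "\<And>v. v \<in> carrier_vec m \<Longrightarrow> B *\<^sub>v v = 0\<^sub>v n \<Longrightarrow> v = 0\<^sub>v m"
  shows pinv_carrier: "pinv B \<in> carrier_mat m n"
    and pinv_mult_self: "pinv B * B = 1\<^sub>m m"
    and pinv_mult_eq_0: "\<And>r. r \<in> carrier_vec n \<Longrightarrow> B\<^sup>T *\<^sub>v r = 0\<^sub>v m \<Longrightarrow> pinv B *\<^sub>v r = 0\<^sub>v m"
proof -
  let ?G = "B\<^sup>T * B"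
  have G: "?G \<in> carrier_mat m m" using B by simp
  have "det ?G \<noteq> 0"
    using det_0_iff_vec_prod_zero_field[OF G] gram_inj[OF B] inj by blast
  then have "?G \<in> Units (ring_mat TYPE(real) m ())" by (rule det_non_zero_imp_unit[OF G])
  then obtain H where "mat_inverse ?G = Some H" using mat_inverse(1)[OF G, where b = "()"] by blast
  then have H: "H * ?G = 1\<^sub>m m" "H \<in> carrier_mat m m" and p: "pinv B = H * B\<^sup>T"
    using mat_inverse(2)[OF G] by (auto simp: pinv_def)
  show "pinv B \<in> carrier_mat m n" using p H B by simp
  show "pinv B * B = 1\<^sub>m m" using p H B by simp
  show "pinv B *\<^sub>v r = 0\<^sub>v m" if "r \<in> carrier_vec n" "B\<^sup>T *\<^sub>v r = 0\<^sub>v m" for r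
  proof -
    have "pinv B *\<^sub>v r = H *\<^sub>v (B\<^sup>T *\<^sub>v r)" using p H B that(1) by simp
    also have "\<dots> = 0\<^sub>v m" using H(2) unfolding that(2) by (intro eq_vecI) auto
    finally show ?thesis .
  qed
qed

section \<open>Comparison of Euclidean norms\<close>

lemma euclidean_norm_add_le:
  assumes "dim_vec u = dim_vec v"
  shows "euclidean_norm (u + v) \<le> euclidean_norm u + euclidean_norm v"
  using L2_set_triangle_ineq[of "\<lambda>i. u $ i" "\<lambda>i. v $ i" "{..<dim_vec v}"] assms
  by (simp add: euclidean_norm_def cong: L2_set_cong_simp)

lemma euclidean_norm_diff_le_add:
  assumes "dim_vec u = dim_vec v"
  shows "euclidean_norm u - euclidean_norm v \<le> euclidean_norm (u + v)"
proof -
  have "euclidean_norm (- v) = euclidean_norm v"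
    by (simp add: euclidean_norm_def L2_set_def)
  moreover have "(u + v) + (- v) = u" using assms by (intro eq_vecI) auto
  ultimately show ?thesis using euclidean_norm_add_le[of "u + v" "- v"] assms by simp
qed

text \<open>Both norms are compared with those of constant functions,
  \<open>sqrt (card J) * M\<close> and \<open>sqrt (card I) * \<mu>\<close>; equal cardinalities
  reduce the claim to the bound between \<open>M\<close> and \<mu>.\<close>

lemma L2_set_comparison:
  fixes f g :: "nat \<Rightarrow> real"
  assumes "\<And>i. i \<in> I \<Longrightarrow> \<mu> \<le> \<bar>f i\<bar>" and "\<And>j. j \<in> J \<Longrightarrow> \<bar>g j\<bar> \<le> M"
    and "\<alpha> * M \<le> \<mu>" "0 \<le> \<alpha>" "0 \<le> M" "card I = card J"
  shows "\<alpha> * L2_set g J \<le> L2_set f I"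
proof -
  \<comment> \<open>Monotonicity of \<open>L2_set\<close> requires the smaller function, here the
    constant \<mu>, to be nonnegative.\<close>
  have "0 \<le> \<mu>" using assms(3-5) mult_nonneg_nonneg order_trans by blast
  have abs: "L2_set (\<lambda>i. \<bar>h i\<bar>) K = L2_set h K" for h :: "nat \<Rightarrow> real" and K
    by (simp add: L2_set_def)
  have "L2_set g J \<le> sqrt (card J) * M"
    using L2_set_mono[of J "\<lambda>j. \<bar>g j\<bar>" "\<lambda>_. M"] assms by (simp add: abs L2_set_constant)
  then have "\<alpha> * L2_set g J \<le> \<alpha> * (sqrt (card J) * M)"
    using assms(4) by (rule mult_left_mono)
  also have "\<dots> = sqrt (card I) * (\<alpha> * M)" using assms(6) by simp
  also have "\<dots> \<le> sqrt (card I) * \<mu>" using assms(3) by (intro mult_left_mono) auto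
  also have "\<dots> \<le> L2_set f I"
    using L2_set_mono[of I "\<lambda>_. \<mu>" "\<lambda>i. \<bar>f i\<bar>"] assms(1) \<open>0 \<le> \<mu>\<close>
    by (simp add: abs L2_set_constant)
  finally show ?thesis .
qed

section \<open>From the stability condition to the norm inequality\<close>

theorem theorem3p2:
  fixes k n N :: nat and A :: "real mat" and xs e b :: "real vec"
    and \<alpha> :: real and \<Lambda> \<Gamma> :: "nat set"
  assumes "0 < 2 * k" and "2 * k \<le> n" and "n \<le> N"
    and "A \<in> carrier_mat n N"
    and "\<forall>J. J \<subseteq> {..<N} \<and> card J = 2 * k \<longrightarrow> lin_indpt_cols (restrict_cols A J)"
    and "xs \<in> carrier_vec N" and "\<Lambda> = supp xs" and "card \<Lambda> = k"
    and "e \<in> carrier_vec n" and "b = A *\<^sub>v xs + e"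
    and "\<alpha> > 0"
    and "\<Gamma> \<subseteq> {..<N}" and "card \<Gamma> = k" and "\<Gamma> \<noteq> \<Lambda>"
    and "\<exists>x. stable_point A b k \<alpha> \<Gamma> x"
  shows "euclidean_norm (pinv (restrict_cols A \<Gamma>) *\<^sub>v
            (restrict_cols A (\<Lambda> - \<Gamma>) *\<^sub>v restrict_vec xs (\<Lambda> - \<Gamma>)))
         + euclidean_norm (pinv (restrict_cols A \<Gamma>) *\<^sub>v e)
       \<ge> \<alpha> *
         (euclidean_norm ((restrict_cols A (\<Lambda> - \<Gamma>))\<^sup>T *\<^sub>v
            ((1\<^sub>m n - restrict_cols A \<Gamma> * pinv (restrict_cols A \<Gamma>)) *\<^sub>v
              (restrict_cols A (\<Lambda> - \<Gamma>) *\<^sub>v restrict_vec xs (\<Lambda> - \<Gamma>))))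
          - euclidean_norm ((restrict_cols A (\<Lambda> - \<Gamma>))\<^sup>T *\<^sub>v
            ((1\<^sub>m n - restrict_cols A \<Gamma> * pinv (restrict_cols A \<Gamma>)) *\<^sub>v e)))"
proof -
  define B where "B = restrict_cols A \<Gamma>"
  define C where "C = restrict_cols A (\<Lambda> - \<Gamma>)"
  define w where "w = C *\<^sub>v restrict_vec xs (\<Lambda> - \<Gamma>)"
  define P where "P = 1\<^sub>m n - B * pinv B"
  note A = assms(4) and xs = assms(6) and e = assms(9)
  note \<Gamma> = \<open>\<Gamma> \<subseteq> {..<N}\<close> \<open>card \<Gamma> = k\<close>
  have \<Lambda>: "\<Lambda> \<subseteq> {..<N}" using assms(6,7) by (auto simp: supp_def)
  then have LG: "\<Lambda> - \<Gamma> \<subseteq> {..<N}" by blast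
  have fin: "finite \<Gamma>" "finite \<Lambda>" using \<Gamma> \<Lambda> finite_subset by blast+
  obtain x where stable: "stable_point A b k \<alpha> \<Gamma> x" using assms(15) by blast
  define r where "r = b - A *\<^sub>v x"
  let ?g = "A\<^sup>T *\<^sub>v r"
  define \<mu> where "\<mu> = Min ((\<lambda>i. \<bar>x $ i\<bar>) ` \<Gamma>)"
  define M where "M = Max ((\<lambda>j. \<bar>?g $ j\<bar>) ` ({..<N} - \<Gamma>))"
  have x: "x \<in> carrier_vec N" "supp x \<subseteq> \<Gamma>" and stat: "restrict_vec ?g \<Gamma> = 0\<^sub>v k"
    and \<mu>M: "\<alpha> * M \<le> \<mu>"
    using stable A by (auto simp: stable_point_def r_def \<mu>_def M_def)
  have B: "B \<in> carrier_mat n k" using restrict_cols_carrier[OF A \<Gamma>(1)] \<Gamma>(2) by (simp add: B_def)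
  have C: "C \<in> carrier_mat n (card (\<Lambda> - \<Gamma>))" using restrict_cols_carrier[OF A LG] by (simp add: C_def)
  have w: "w \<in> carrier_vec n" using C by (simp add: w_def carrier_vecI)

  \<comment> \<open>Since \<open>2 * k \<le> n \<le> N\<close>, there is room to enlarge \<Gamma> to
    a set covered by the independence hypothesis.\<close>
  obtain J where J: "\<Gamma> \<subseteq> J" "J \<subseteq> {..<N}" "card J = 2 * k"
    using exists_subset_between[of \<Gamma> "2 * k" "{..<N}"] \<Gamma> assms(2,3) by auto
  have inj: "v = 0\<^sub>v k" if "v \<in> carrier_vec k" "B *\<^sub>v v = 0\<^sub>v n" for v
    using restrict_cols_inj_subset[OF A J(2,1), of v] J assms(5) \<Gamma> that by (simp add: B_def)
  note pinv = pinv_carrier[OF B inj] pinv_mult_self[OF B inj] pinv_mult_eq_0[OF B inj]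
  have P: "P \<in> carrier_mat n n" using B pinv(1) unfolding P_def by (intro minus_carrier_mat mult_carrier_mat)

  define xG where "xG = restrict_vec x \<Gamma>"
  define sG where "sG = restrict_vec xs \<Gamma>"
  have xG: "xG \<in> carrier_vec k" and sG: "sG \<in> carrier_vec k"
    using restrict_vec_carrier x(1) xs \<Gamma> by (auto simp: xG_def sG_def)
  have Ax: "A *\<^sub>v x = B *\<^sub>v xG"
    using restrict_mult_of_supp_subset[OF A x(1) \<Gamma>(1) x(2)] by (simp add: B_def xG_def)
  have Axs: "A *\<^sub>v xs = B *\<^sub>v sG + w"
    using mult_restrict_split[OF A xs \<Gamma>(1)] assms(7) by (simp add: B_def C_def w_def sG_def)
  \<comment> \<open>The residual differs from \<open>w + e\<close> by an element of the range of
    \<open>B\<close>; applying \<open>pinv B\<close>, which kills \<open>r\<close>, determines that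
    element.\<close>
  have r: "r = B *\<^sub>v (sG - xG) + (w + e)"
    using B xG sG w e mult_minus_distrib_mat_vec[OF B sG xG] assms(10)
    by (intro eq_vecI) (auto simp: r_def Ax Axs)
  have rc: "r \<in> carrier_vec n" using r B sG xG w e by simp
  have "B\<^sup>T *\<^sub>v r = 0\<^sub>v k" using restrict_transpose_mult[OF A \<Gamma>(1)] stat by (simp add: B_def)
  then have "0\<^sub>v k = pinv B *\<^sub>v r" using pinv(3)[OF _ _ rc] by simp
  also have "\<dots> = pinv B *\<^sub>v (B *\<^sub>v (sG - xG)) + pinv B *\<^sub>v (w + e)"
    using B sG xG w e by (simp add: r mult_add_distrib_mat_vec[OF pinv(1)])
  also have "pinv B *\<^sub>v (B *\<^sub>v (sG - xG)) = sG - xG"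
    using assoc_mult_mat_vec[OF pinv(1) B, of "sG - xG"] pinv(2) sG xG by simp
  finally have zero: "0\<^sub>v k = (sG - xG) + pinv B *\<^sub>v (w + e)" by blast
  have d: "pinv B *\<^sub>v (w + e) = xG - sG"
  proof (rule eq_vecI)
    fix i assume "i < dim_vec (xG - sG)"
    then have "i < k" using sG by simp
    then show "(pinv B *\<^sub>v (w + e)) $ i = (xG - sG) $ i"
      using arg_cong[OF zero, of "\<lambda>v. v $ i"] pinv(1) sG xG by simp
  qed (use pinv(1) sG in auto)
  \<comment> \<open>With \<open>pinv B *\<^sub>v (w + e)\<close> known, \<open>P\<close> subtracts
    exactly the part of \<open>w + e\<close> by which it differs from the residual.\<close>
  have "P *\<^sub>v (w + e) = (w + e) - B *\<^sub>v (xG - sG)"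
    using w e minus_mult_distrib_mat_vec[OF one_carrier_mat mult_carrier_mat[OF B pinv(1)], of "w + e"]
      assoc_mult_mat_vec[OF B pinv(1), of "w + e"] by (simp add: P_def d)
  then have Pr: "P *\<^sub>v (w + e) = r"
    using w e B xG sG mult_minus_distrib_mat_vec[OF B xG sG] mult_minus_distrib_mat_vec[OF B sG xG]
    by (intro eq_vecI) (auto simp: r)

  have gc: "?g \<in> carrier_vec N" using A by (intro carrier_vecI) simp
  have "xG - sG = restrict_vec (x - xs) \<Gamma>"
    using restrict_vec_diff[OF x(1) xs \<Gamma>(1)] by (simp add: xG_def sG_def)
  then have nd: "euclidean_norm (pinv B *\<^sub>v (w + e)) = L2_set (\<lambda>i. (x - xs) $ i) \<Gamma>"
    using d euclidean_norm_restrict_vec[of "x - xs" N \<Gamma>] x xs \<Gamma> by simp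
  have ng: "euclidean_norm (C\<^sup>T *\<^sub>v (P *\<^sub>v (w + e))) = L2_set (\<lambda>j. ?g $ j) (\<Lambda> - \<Gamma>)"
    using restrict_transpose_mult[OF A LG] euclidean_norm_restrict_vec[OF gc LG]
    by (simp add: C_def Pr)

  have card: "card (\<Gamma> - \<Lambda>) = card (\<Lambda> - \<Gamma>)"
    using fin \<Gamma> assms(8) by (simp add: card_Diff_subset_Int Int_commute)
  \<comment> \<open>Distinct sets of equal size leave an index in \<Lambda> - \<Gamma>. It shows
    that \<open>M\<close> is a maximum over a nonempty set, hence nonnegative.\<close>
  have "\<not> \<Lambda> \<subseteq> \<Gamma>" using card_subset_eq[OF fin(1)] \<Gamma> assms(8,14) by metis
  then obtain j where "j \<in> \<Lambda> - \<Gamma>" by blast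
  have M: "\<bar>?g $ j\<bar> \<le> M" if "j \<in> \<Lambda> - \<Gamma>" for j
    using that \<Lambda> by (auto simp: M_def intro!: Max_ge)
  have "\<alpha> * L2_set (\<lambda>j. ?g $ j) (\<Lambda> - \<Gamma>) \<le> L2_set (\<lambda>i. (x - xs) $ i) (\<Gamma> - \<Lambda>)"
  proof (rule L2_set_comparison)
    show "0 \<le> M" using M[OF \<open>j \<in> \<Lambda> - \<Gamma>\<close>] by linarith
    show "\<mu> \<le> \<bar>(x - xs) $ i\<bar>" if "i \<in> \<Gamma> - \<Lambda>" for i
    proof -
      have "i < N" using that \<Gamma> by auto
      then have "(x - xs) $ i = x $ i" using that x xs assms(7) by (auto simp: supp_def)
      then show ?thesis using that fin by (auto simp: \<mu>_def intro!: Min_le)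
    qed
  qed (use M \<mu>M assms(11) card in auto)
  \<comment> \<open>Passing from \<Gamma> - \<Lambda> to \<Gamma> only adds squares.\<close>
  also have "\<dots> \<le> L2_set (\<lambda>i. (x - xs) $ i) \<Gamma>"
    unfolding L2_set_def using fin by (intro real_sqrt_le_mono sum_mono2) auto
  finally have main: "\<alpha> * euclidean_norm (C\<^sup>T *\<^sub>v (P *\<^sub>v (w + e)))
      \<le> euclidean_norm (pinv B *\<^sub>v (w + e))"
    by (simp add: nd ng)

  \<comment> \<open>By linearity \<open>w\<close> and \<open>e\<close> separate: the reverse
    triangle inequality bounds the gradient side from below, the ordinary one bounds the
    pseudoinverse side from above.\<close>
  have "C\<^sup>T *\<^sub>v (P *\<^sub>v (w + e)) = C\<^sup>T *\<^sub>v (P *\<^sub>v w) + C\<^sup>T *\<^sub>v (P *\<^sub>v e)"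
    using C P w e by (simp add: mult_add_distrib_mat_vec[where nr = n and nc = n]
      mult_add_distrib_mat_vec[where nc = n])
  then have "\<alpha> * (euclidean_norm (C\<^sup>T *\<^sub>v (P *\<^sub>v w)) - euclidean_norm (C\<^sup>T *\<^sub>v (P *\<^sub>v e)))
      \<le> \<alpha> * euclidean_norm (C\<^sup>T *\<^sub>v (P *\<^sub>v (w + e)))"
    using assms(11) euclidean_norm_diff_le_add by (intro mult_left_mono) auto
  also note main
  also have "euclidean_norm (pinv B *\<^sub>v (w + e))
      \<le> euclidean_norm (pinv B *\<^sub>v w) + euclidean_norm (pinv B *\<^sub>v e)"
    using euclidean_norm_add_le mult_add_distrib_mat_vec[OF pinv(1) w e] by simp
  finally show ?thesis by (simp add: B_def C_def w_def P_def)
qed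

end
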